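(* Let $V$ and $W$ be probability spaces with total cumulants $K_V:SV\to S\mathbb{C}$ and $K_W:SW\to S\mathbb{C}$, and let $\alpha:V\to W$ be a morphism of probability spaces which preserves the algebra structure, i.e. $\alpha(ab)=\alpha(a)\alpha(b)$ for all $a,b\in V$. Then $\alpha$ preserves total cumulants: $K_W\circ\alpha=K_V$, where on the left $\alpha$ denotes the coalgebra map $SV\to SW$, $a_1\odot\cdots\odot a_n\mapsto \alpha(a_1)\odot\cdots\odot\alpha(a_n)$.
   Context: All vector spaces are over $\mathbb{C}$. Chain complexes are $\mathbb{Z}$-graded with differential of degree $+1$; $\mathbb{C}$ is regarded as a complex concentrated in degree $0$ with zero differential. Probability space. A (unital commutative homotopy) probability space is a chain complex $(V,d)$ with a chain map $\upsilon:\mathbb{C}\to V$ (the unit, identified with $\upsilon(1)=1\in V$), a graded commutative associative product on $V$ for which $\upsilon(1)$ is the identity (no compatibility between product and $d$ is assumed), and a chain map $e:V\to\mathbb{C}$ (the expectation) with $e\upsilon=\mathrm{id}_{\mathbb{C}}$ (no compatibility between $e$ and the product is assumed). A morphism of probability spaces $\alpha:V\to W$ is a chain map commuting with the units and the expectations ($\alpha\upsilon_V=\upsilon_W$, $e_W\alpha=e_V$); it is not in general required to respect the products. Coalgebras. For a graded vector space $V$, $SV=\bigoplus_{k\ge1}S^kV$ is the cofree nilpotent graded cocommutative coalgebra on $V$. A coalgebra map $F:SV\to SW$ is determined by its components $F_k:S^kV\to W$ via $F(a_1\odot\cdots\odot a_n)=\sum_{\pi}\pm\bigodot_{B\in\pi}F_{|B|}(a_B)$,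 the sum being over partitions $\pi$ of the set $\{1,\dots,n\}$, with Koszul signs, where $a_B$ is the symmetric product of the $a_i$, $i\in B$. A degree $0$ linear map $V\to W$ is viewed as the coalgebra map with only that linear component. Total cumulant. For $V$ with a graded commutative associative product, $\varphi:SV\to SV$ is the coalgebra automorphism with components $a_1\odot\cdots\odot a_n\mapsto a_1\cdots a_n$. For a linear map $f:SV\to SW$, put $f^\varphi=\varphi^{-1}f\varphi$ (with $\varphi$ of $V$ on the right and $\varphi^{-1}$ of $W$ on the left). The total cumulant of a probability space $V$ is $K_V=e^\varphi:SV\to S\mathbb{C}$, where $e$ is regarded as a coalgebra map $SV\to S\mathbb{C}$ and $\mathbb{C}$ has its usual product. *)

theory Defs
  imports Complex_Main "HOL-Library.Poly_Mapping" "HOL-Library.Disjoint_Sets"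
begin

class complex_vector = ab_group_add +
  fixes scaleC :: "complex \<Rightarrow> 'a \<Rightarrow> 'a"  (infixr \<open>*\<^sub>C\<close> 75)
  assumes scaleC_add_right: "a *\<^sub>C (x + y) = a *\<^sub>C x + a *\<^sub>C y"
    and scaleC_add_left: "(a + b) *\<^sub>C x = a *\<^sub>C x + b *\<^sub>C x"
    and scaleC_scaleC: "a *\<^sub>C b *\<^sub>C x = (a * b) *\<^sub>C x"
    and scaleC_one: "1 *\<^sub>C x = x"

global_interpretation complex_vector: vector_space "scaleC :: complex \<Rightarrow> 'a \<Rightarrow> 'a::complex_vector"
  by unfold_locales (fact scaleC_add_right scaleC_add_left scaleC_scaleC scaleC_one)+

abbreviation clinear :: "('a::complex_vector \<Rightarrow> 'b::complex_vector) \<Rightarrow> bool"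
  where "clinear \<equiv> Vector_Spaces.linear scaleC scaleC"

text \<open>
  A \<open>\<int>\<close>-graded vector space is the internal direct sum of its homogeneous components:
  every element is, in exactly one way, a finite sum of homogeneous elements of distinct degrees.
\<close>

class graded_vector = complex_vector +
  fixes hcomp :: "int \<Rightarrow> 'a set"
  assumes hcomp_zero: "0 \<in> hcomp i"
    and hcomp_add: "a \<in> hcomp i \<Longrightarrow> b \<in> hcomp i \<Longrightarrow> a + b \<in> hcomp i"
    and hcomp_scaleC: "a \<in> hcomp i \<Longrightarrow> c *\<^sub>C a \<in> hcomp i"
    and hcomp_direct_sum:
      "\<exists>!f. (\<forall>i. f i \<in> hcomp i) \<and> finite {i. f i \<noteq> 0} \<and> a = (\<Sum>i | f i \<noteq> 0. f i)"

text \<open>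
  The axiom \<open>0 \<noteq> 1\<close> of \<^class>\<open>ring_1\<close> holds in every probability space, because the expectation
  sends the unit to \<open>1\<close>.
\<close>

class graded_comm_algebra = graded_vector + ring_1 +
  assumes mult_scaleC_left: "(c *\<^sub>C a) * b = c *\<^sub>C (a * b)"
    and mult_scaleC_right: "a * (c *\<^sub>C b) = c *\<^sub>C (a * b)"
    and mult_hcomp: "a \<in> hcomp i \<Longrightarrow> b \<in> hcomp j \<Longrightarrow> a * b \<in> hcomp (i + j)"
    and graded_commute:
      "a \<in> hcomp i \<Longrightarrow> b \<in> hcomp j \<Longrightarrow> a * b = ((- 1) powi (i * j)) *\<^sub>C (b * a)"

instantiation complex :: graded_comm_algebra
begin

definition scaleC_complex :: "complex \<Rightarrow> complex \<Rightarrow> complex"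
  where "scaleC_complex = (*)"

definition hcomp_complex :: "int \<Rightarrow> complex set"
  where "hcomp_complex i = (if i = 0 then UNIV else {0})"

instance
proof
  fix a :: complex
  let ?P = "\<lambda>f. (\<forall>i. f i \<in> hcomp i) \<and> finite {i. f i \<noteq> 0} \<and> a = (\<Sum>i | f i \<noteq> 0. f i)"
  show "\<exists>!f. ?P f"
  proof
    have "{i::int. (if i = 0 then a else 0) \<noteq> 0} = (if a = 0 then {} else {0})" by auto
    then show "?P (\<lambda>i. if i = 0 then a else 0)" by (auto simp: hcomp_complex_def)
  next
    fix f :: "int \<Rightarrow> complex" assume f: "?P f"
    then have z: "f i = 0" if "i \<noteq> 0" for i
      using that by (auto simp: hcomp_complex_def dest: spec[of _ i])
    have "(\<Sum>i | f i \<noteq> 0. f i) = f 0"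
    proof (cases "f 0 = 0")
      case True
      then have "{i. f i \<noteq> 0} = {}" using z by (metis (mono_tags, lifting) Collect_empty_eq)
      then show ?thesis using True by simp
    next
      case False
      then have "{i. f i \<noteq> 0} = {0}" using z by auto
      then show ?thesis by simp
    qed
    with f z show "f = (\<lambda>i. if i = 0 then a else 0)" by auto
  qed
qed (auto simp: scaleC_complex_def hcomp_complex_def algebra_simps split: if_splits)

end

locale chain_complex =
  fixes d :: "'a::graded_vector \<Rightarrow> 'a"
  assumes d_linear: "clinear d"
    and d_degree: "a \<in> hcomp i \<Longrightarrow> d a \<in> hcomp (i + 1)"
    and d_d: "d (d a) = 0"

locale chain_map = source: chain_complex dV + target: chain_complex dW
  for dV :: "'a::graded_vector \<Rightarrow> 'a" and dW :: "'b::graded_vector \<Rightarrow> 'b" +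
  fixes f :: "'a \<Rightarrow> 'b"
  assumes f_linear: "clinear f"
    and f_degree: "a \<in> hcomp i \<Longrightarrow> f a \<in> hcomp i"
    and f_d: "f (dV a) = dW (f a)"

locale homotopy_prob_space =
  unit: chain_map "\<lambda>_. 0" d \<upsilon> + expectation: chain_map d "\<lambda>_. 0" e
  for d :: "'a::graded_comm_algebra \<Rightarrow> 'a" and \<upsilon> :: "complex \<Rightarrow> 'a" and e :: "'a \<Rightarrow> complex" +
  assumes unit_one: "\<upsilon> 1 = 1"
    and expectation_unit: "e \<circ> \<upsilon> = id"

locale homotopy_prob_morphism =
  source: homotopy_prob_space dV \<upsilon>V eV + target: homotopy_prob_space dW \<upsilon>W eW +
  chain_map dV dW \<alpha>
  for dV :: "'a::graded_comm_algebra \<Rightarrow> 'a" and \<upsilon>V eV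
    and dW :: "'b::graded_comm_algebra \<Rightarrow> 'b" and \<upsilon>W eW and \<alpha> +
  assumes map_unit: "\<alpha> \<circ> \<upsilon>V = \<upsilon>W"
    and map_expectation: "eW \<circ> \<alpha> = eV"

text \<open>
  \<open>SV\<close> is the free vector space on nonempty words of homogeneous elements of \<open>V\<close>, modulo linearity
  in each letter and the Koszul rule for exchanging neighbouring letters.  Each letter carries its
  degree, as the degree of a homogeneous element is not determined when that element is \<open>0\<close>.
\<close>

definition hom_words :: "(int \<times> 'a::graded_vector) list set"
  where "hom_words = {w. w \<noteq> [] \<and> (\<forall>(i, a) \<in> set w. a \<in> hcomp i)}"

instantiation poly_mapping :: (type, complex_vector) complex_vector
begin

lift_definition scaleC_poly_mapping :: "complex \<Rightarrow> ('a \<Rightarrow>\<^sub>0 'b) \<Rightarrow> 'a \<Rightarrow>\<^sub>0 'b"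
  is "\<lambda>c f k. c *\<^sub>C f k"
  by (erule finite_subset[rotated]) auto

instance
  by standard
    (transfer; simp add: fun_eq_iff scaleC_add_right scaleC_add_left scaleC_scaleC scaleC_one)+

end

inductive_set sym_relators :: "((int \<times> 'a::graded_vector) list \<Rightarrow>\<^sub>0 complex) set" where
  add: "u @ (i, a) # v \<in> hom_words \<Longrightarrow> b \<in> hcomp i \<Longrightarrow>
    Poly_Mapping.single (u @ (i, a + b) # v) 1
      - Poly_Mapping.single (u @ (i, a) # v) 1 - Poly_Mapping.single (u @ (i, b) # v) 1
    \<in> sym_relators"
| scale: "u @ (i, a) # v \<in> hom_words \<Longrightarrow>
    Poly_Mapping.single (u @ (i, c *\<^sub>C a) # v) 1 - c *\<^sub>C Poly_Mapping.single (u @ (i, a) # v) 1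
    \<in> sym_relators"
| swap: "u @ (i, a) # (j, b) # v \<in> hom_words \<Longrightarrow>
    Poly_Mapping.single (u @ (i, a) # (j, b) # v) 1
      - ((- 1) powi (i * j)) *\<^sub>C Poly_Mapping.single (u @ (j, b) # (i, a) # v) 1
    \<in> sym_relators"

definition sym_rel :: "((int \<times> 'a::graded_vector) list \<Rightarrow>\<^sub>0 complex) \<Rightarrow> _ \<Rightarrow> bool"
  where "sym_rel p q \<longleftrightarrow> Poly_Mapping.keys p \<subseteq> hom_words \<and> Poly_Mapping.keys q \<subseteq> hom_words
    \<and> p - q \<in> complex_vector.span sym_relators"

lemma sym_relI: "p = q \<Longrightarrow> Poly_Mapping.keys p \<subseteq> hom_words \<Longrightarrow> sym_rel p q"
  by (simp add: sym_rel_def complex_vector.span_zero)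

lemma keys_hom_words_closed:
  fixes p q :: "(int \<times> 'a::graded_vector) list \<Rightarrow>\<^sub>0 complex"
  shows "Poly_Mapping.keys p \<subseteq> hom_words \<Longrightarrow> Poly_Mapping.keys q \<subseteq> hom_words
      \<Longrightarrow> Poly_Mapping.keys (p + q) \<subseteq> hom_words"
    and "Poly_Mapping.keys p \<subseteq> hom_words \<Longrightarrow> Poly_Mapping.keys (- p) \<subseteq> hom_words"
    and "Poly_Mapping.keys p \<subseteq> hom_words \<Longrightarrow> Poly_Mapping.keys (c *\<^sub>C p) \<subseteq> hom_words"
  using keys_add[of p q]
  by (blast, simp add: keys.rep_eq, auto simp: keys.rep_eq scaleC_poly_mapping.rep_eq)

quotient_type (overloaded) 'a sym =
  "(int \<times> 'a::graded_vector) list \<Rightarrow>\<^sub>0 complex" / partial: sym_rel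
proof (rule part_equivpI)
  show "\<exists>p :: (int \<times> 'a) list \<Rightarrow>\<^sub>0 complex. sym_rel p p"
    by (rule exI[of _ 0]) (simp add: sym_relI)
  show "symp (sym_rel :: ((int \<times> 'a) list \<Rightarrow>\<^sub>0 complex) \<Rightarrow> _)"
    by (rule sympI) (auto simp: sym_rel_def dest: complex_vector.span_neg)
  show "transp (sym_rel :: ((int \<times> 'a) list \<Rightarrow>\<^sub>0 complex) \<Rightarrow> _)"
  proof (rule transpI)
    fix p q r :: "(int \<times> 'a) list \<Rightarrow>\<^sub>0 complex" assume "sym_rel p q" "sym_rel q r"
    then show "sym_rel p r"
      using complex_vector.span_add[of "p - q" sym_relators "q - r"] by (simp add: sym_rel_def)
  qed
qed

instantiation sym :: (graded_vector) complex_vector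
begin

lift_definition zero_sym :: "'a sym" is 0
  by (simp add: sym_relI)

lift_definition plus_sym :: "'a sym \<Rightarrow> 'a sym \<Rightarrow> 'a sym" is "(+)"
proof -
  fix p p' q q' :: "(int \<times> 'a) list \<Rightarrow>\<^sub>0 complex"
  assume "sym_rel p p'" "sym_rel q q'"
  then show "sym_rel (p + q) (p' + q')"
    using complex_vector.span_add[of "p - p'" sym_relators "q - q'"]
    by (auto simp: sym_rel_def keys_hom_words_closed algebra_simps)
qed

lift_definition uminus_sym :: "'a sym \<Rightarrow> 'a sym" is uminus
proof -
  fix p q :: "(int \<times> 'a) list \<Rightarrow>\<^sub>0 complex" assume "sym_rel p q"
  then show "sym_rel (- p) (- q)"
    using complex_vector.span_neg[of "p - q" sym_relators]
    by (auto simp: sym_rel_def keys_hom_words_closed)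
qed

lift_definition scaleC_sym :: "complex \<Rightarrow> 'a sym \<Rightarrow> 'a sym" is "(*\<^sub>C)"
proof -
  fix c and p q :: "(int \<times> 'a) list \<Rightarrow>\<^sub>0 complex" assume "sym_rel p q"
  then show "sym_rel (c *\<^sub>C p) (c *\<^sub>C q)"
    using complex_vector.span_scale[of "p - q" sym_relators c]
    by (auto simp: sym_rel_def keys_hom_words_closed complex_vector.scale_right_diff_distrib)
qed

definition minus_sym :: "'a sym \<Rightarrow> 'a sym \<Rightarrow> 'a sym"
  where "minus_sym x y = x + - y"

instance
proof
  fix x y z :: "'a sym" and a b :: complex
  note closed = keys_hom_words_closed sym_rel_def[of p p for p]
  show "x + y + z = x + (y + z)"
    by transfer (rule sym_relI; simp add: closed algebra_simps)
  show "x + y = y + x"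
    by transfer (rule sym_relI; simp add: closed algebra_simps)
  show "0 + x = x"
    by transfer (rule sym_relI; simp add: closed)
  show "- x + x = 0"
    by transfer (rule sym_relI; simp add: closed)
  show "x - y = x + - y"
    by (simp add: minus_sym_def)
  show "a *\<^sub>C (x + y) = a *\<^sub>C x + a *\<^sub>C y"
    by transfer (rule sym_relI; simp add: closed scaleC_add_right)
  show "(a + b) *\<^sub>C x = a *\<^sub>C x + b *\<^sub>C x"
    by transfer (rule sym_relI; simp add: closed scaleC_add_left)
  show "a *\<^sub>C b *\<^sub>C x = (a * b) *\<^sub>C x"
    by transfer (rule sym_relI; simp add: closed scaleC_scaleC)
  show "1 *\<^sub>C x = x"
    by transfer (rule sym_relI; simp add: closed scaleC_one)
qed

end

text \<open>
  \<open>sym_prod\<close> sends a word \<open>a\<^sub>1, \<dots>, a\<^sub>n\<close> in \<open>hom_words\<close> to \<open>a\<^sub>1 \<odot> \<dots> \<odot> a\<^sub>n\<close>; other words get the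
  dummy value \<open>0\<close>.
\<close>

lift_definition sym_prod :: "(int \<times> 'a::graded_vector) list \<Rightarrow> 'a sym"
  is "\<lambda>w. if w \<in> hom_words then Poly_Mapping.single w 1 else 0"
  by (simp add: sym_relI)

text \<open>
  The elements \<open>sym_prod w\<close> span \<open>SV\<close>, so \<open>F\<close> is unique; it exists exactly when \<open>f\<close> is linear in
  each letter and obeys the Koszul rule on \<open>hom_words\<close>, as it does below for components of degree \<open>0\<close>.
\<close>

definition sym_extend ::
    "((int \<times> 'a::graded_vector) list \<Rightarrow> 'b::complex_vector) \<Rightarrow> 'a sym \<Rightarrow> 'b"
  where "sym_extend f = (THE F. clinear F \<and> (\<forall>w\<in>hom_words. F (sym_prod w) = f w))"

definition word_degree :: "(int \<times> 'a) list \<Rightarrow> int"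
  where "word_degree w = sum_list (map fst w)"

definition subword :: "'a list \<Rightarrow> nat list \<Rightarrow> 'a list"
  where "subword w l = map ((!) w) l"

text \<open>
  The Koszul sign of the rearrangement of letters of degrees \<open>ds\<close> into the order given by the
  list of positions: a factor \<open>(-1)\<^bsup>|a\<^sub>x||a\<^sub>y|\<^esup>\<close> for each inversion.
\<close>

primrec koszul_sign :: "int list \<Rightarrow> nat list \<Rightarrow> complex" where
  "koszul_sign ds [] = 1"
| "koszul_sign ds (x # xs) =
    (\<Prod>y\<leftarrow>filter (\<lambda>y. y < x) xs. (- 1) powi (ds ! x * ds ! y)) * koszul_sign ds xs"

text \<open>
  The blocks of a set partition, ordered by their minima and each listed in increasing order.
  For components of degree \<open>0\<close>, the summand \<open>coalg_term\<close> is the same for any other ordering.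
\<close>

definition blocks :: "nat set set \<Rightarrow> nat list list"
  where "blocks \<pi> = map sorted_list_of_set (sorted_key_list_of_set Min \<pi>)"

definition coalg_term ::
    "('a::graded_vector sym \<Rightarrow> 'b::graded_vector) \<Rightarrow> (int \<times> 'a) list \<Rightarrow> nat list list \<Rightarrow> 'b sym"
  where "coalg_term F w L = koszul_sign (map fst w) (concat L) *\<^sub>C
    sym_prod (map (\<lambda>l. (word_degree (subword w l), F (sym_prod (subword w l)))) L)"

text \<open>
  The coalgebra map with components \<open>F\<^sub>k : S\<^sup>kV \<rightarrow> W\<close>, these being packed into one
  linear map \<open>F : SV \<rightarrow> W\<close> of degree \<open>0\<close>.
\<close>

definition coalg_map ::
    "('a::graded_vector sym \<Rightarrow> 'b::graded_vector) \<Rightarrow> 'a sym \<Rightarrow> 'b sym"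
  where "coalg_map F =
    sym_extend (\<lambda>w. \<Sum>\<pi> | partition_on {..<length w} \<pi>. coalg_term F w (blocks \<pi>))"

definition linear_coalg_map ::
    "('a::graded_vector \<Rightarrow> 'b::graded_vector) \<Rightarrow> 'a sym \<Rightarrow> 'b sym"
  where "linear_coalg_map f =
    coalg_map (sym_extend (\<lambda>w. if length w = 1 then f (snd (hd w)) else 0))"

definition mult_coalg_map :: "'a::graded_comm_algebra sym \<Rightarrow> 'a sym"
  where "mult_coalg_map = coalg_map (sym_extend (\<lambda>w. prod_list (map snd w)))"

text \<open>
  \<open>mult_coalg_map\<close> differs from the identity by a map that lowers word length, hence it is bijective
  and \<open>inv\<close> is its two-sided inverse.
\<close>

definition conj_mult ::
    "('a::graded_comm_algebra sym \<Rightarrow> 'b::graded_comm_algebra sym) \<Rightarrow> 'a sym \<Rightarrow> 'b sym"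
  where "conj_mult f = inv mult_coalg_map \<circ> f \<circ> mult_coalg_map"

definition total_cumulant :: "('a::graded_comm_algebra \<Rightarrow> complex) \<Rightarrow> 'a sym \<Rightarrow> complex sym"
  where "total_cumulant e = conj_mult (linear_coalg_map e)"

end

theory Submission
  imports Defs "HOL-Library.Multiset" "HOL-Combinatorics.Transposition"
begin

text \<open>
  Writing \<open>\<phi>\<close> for \<open>mult_coalg_map\<close>, the total cumulant of \<open>e\<close> is \<open>\<phi>\<^sup>-\<^sup>1 e \<phi>\<close>.  A unital algebra
  homomorphism \<open>\<alpha>\<close> of degree zero satisfies \<open>\<phi> \<alpha> = \<alpha> \<phi>\<close>: on a word, both sides run over the set
  partitions of its positions, and in each summand it makes no difference whether the letters of a block
  are multiplied before or after \<open>\<alpha>\<close> is applied (\<open>mult_coalg_map_natural\<close>).  As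
  \<open>e\<^sub>W \<alpha> = e\<^sub>V\<close>, it follows that
  \<open>\<phi>\<^sup>-\<^sup>1 e\<^sub>W \<phi> \<alpha> = \<phi>\<^sup>-\<^sup>1 e\<^sub>W \<alpha> \<phi> = \<phi>\<^sup>-\<^sup>1 e\<^sub>V \<phi>\<close>.

  The substance lies in computing with maps given by a description: \<open>coalg_map F\<close> may be
  evaluated on words only once the sum over set partitions that defines it has been shown to respect the
  relations of \<open>SV\<close>.  Linearity in a letter holds because each position lies in exactly one block
  (\<open>coalg_term_in_letter\<close>).  For the Koszul rule two facts are combined.  The summand of a set
  partition is the same for every listing of its blocks and of the elements of each block
  (\<open>coalg_term_blocks\<close>), because the sign of the listing compensates the sign produced in \<open>SW\<close> or
  inside \<open>F\<close>.  And exchanging two neighbouring letters while relabelling their positions changes only the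
  sign of the listing (\<open>coalg_term_transpose\<close>).  So the exchange of letters permutes the summands, up to
  the Koszul sign (\<open>coalg_terms_koszul_multilinear\<close>).
\<close>

section \<open>Linear maps out of the symmetric coalgebra\<close>

abbreviation swap_sign :: "int \<Rightarrow> int \<Rightarrow> complex"
  where "swap_sign i j \<equiv> (- 1) powi (i * j)"

text \<open>
  These are the relations that define \<open>SV\<close>: a function on words extends linearly to \<open>SV\<close>
  exactly when it has this property.
\<close>

definition koszul_multilinear ::
    "((int \<times> 'a::graded_vector) list \<Rightarrow> 'b::complex_vector) \<Rightarrow> bool"
  where "koszul_multilinear f \<longleftrightarrow>
    (\<forall>u i a b v. u @ (i, a) # v \<in> hom_words \<longrightarrow> b \<in> hcomp i \<longrightarrow>
      f (u @ (i, a + b) # v) = f (u @ (i, a) # v) + f (u @ (i, b) # v)) \<and>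
    (\<forall>u i a c v. u @ (i, a) # v \<in> hom_words \<longrightarrow>
      f (u @ (i, c *\<^sub>C a) # v) = c *\<^sub>C f (u @ (i, a) # v)) \<and>
    (\<forall>u i a j b v. u @ (i, a) # (j, b) # v \<in> hom_words \<longrightarrow>
      f (u @ (i, a) # (j, b) # v) = swap_sign i j *\<^sub>C f (u @ (j, b) # (i, a) # v))"

lemma koszul_multilinearI:
  assumes "\<And>u i a b v. u @ (i, a) # v \<in> hom_words \<Longrightarrow> b \<in> hcomp i \<Longrightarrow>
      f (u @ (i, a + b) # v) = f (u @ (i, a) # v) + f (u @ (i, b) # v)"
    and "\<And>u i a c v. u @ (i, a) # v \<in> hom_words \<Longrightarrow>
      f (u @ (i, c *\<^sub>C a) # v) = c *\<^sub>C f (u @ (i, a) # v)"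
    and "\<And>u i a j b v. u @ (i, a) # (j, b) # v \<in> hom_words \<Longrightarrow>
      f (u @ (i, a) # (j, b) # v) = swap_sign i j *\<^sub>C f (u @ (j, b) # (i, a) # v)"
  shows "koszul_multilinear f"
  using assms unfolding koszul_multilinear_def by blast

lemma koszul_multilinearD:
  assumes "koszul_multilinear f"
  shows "u @ (i, a) # v \<in> hom_words \<Longrightarrow> b \<in> hcomp i \<Longrightarrow>
      f (u @ (i, a + b) # v) = f (u @ (i, a) # v) + f (u @ (i, b) # v)"
    and "u @ (i, a) # v \<in> hom_words \<Longrightarrow>
      f (u @ (i, c *\<^sub>C a) # v) = c *\<^sub>C f (u @ (i, a) # v)"
    and "u @ (i, a) # (j, b) # v \<in> hom_words \<Longrightarrow>
      f (u @ (i, a) # (j, b) # v) = swap_sign i j *\<^sub>C f (u @ (j, b) # (i, a) # v)"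
  using assms unfolding koszul_multilinear_def by blast+

lemma hom_words_append_Cons [simp]:
  "u @ (i, a) # v \<in> hom_words \<longleftrightarrow>
    (\<forall>(k, x)\<in>set u. x \<in> hcomp k) \<and> a \<in> hcomp i \<and> (\<forall>(k, x)\<in>set v. x \<in> hcomp k)"
  by (auto simp: hom_words_def)

lemma sym_prod_eq_0: "w \<notin> hom_words \<Longrightarrow> sym_prod w = 0"
  by transfer (simp add: sym_relI)

lemma sym_prod_eq_abs: "w \<in> hom_words \<Longrightarrow> sym_prod w = abs_sym (Poly_Mapping.single w 1)"
  by (simp add: sym_prod.abs_eq)

lemma sym_relI_span:
  assumes "p - q \<in> complex_vector.span sym_relators"
    and "Poly_Mapping.keys p \<subseteq> hom_words" and "Poly_Mapping.keys q \<subseteq> hom_words"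
  shows "sym_rel p q"
  using assms by (simp add: sym_rel_def)

lemma keys_single_hom_words: "w \<in> hom_words \<Longrightarrow> Poly_Mapping.keys (Poly_Mapping.single w c) \<subseteq> hom_words"
  using keys_single[of w c] by auto

lemma abs_sym_eqI: "sym_rel p q \<Longrightarrow> abs_sym p = abs_sym q"
  by (rule Quotient_rel_abs[OF Quotient_sym])

lemma abs_sym_add:
  "Poly_Mapping.keys p \<subseteq> hom_words \<Longrightarrow> Poly_Mapping.keys q \<subseteq> hom_words \<Longrightarrow>
    abs_sym (p + q) = abs_sym p + abs_sym q"
  by (simp add: plus_sym.abs_eq sym_relI)

lemma abs_sym_scaleC:
  "Poly_Mapping.keys p \<subseteq> hom_words \<Longrightarrow> abs_sym (c *\<^sub>C p) = c *\<^sub>C abs_sym p"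
  by (simp add: scaleC_sym.abs_eq sym_relI)

text \<open>
  Each of the three identities is one of the generating relators, read in the quotient.
\<close>

lemma sym_prod_koszul_multilinear: "koszul_multilinear sym_prod"
proof (rule koszul_multilinearI)
  fix u v :: "(int \<times> 'a) list" and i j :: int and a b :: 'a and c :: complex
  note rel = sym_relI_span[OF complex_vector.span_base] keys_hom_words_closed keys_single_hom_words
  { assume *: "u @ (i, a) # v \<in> hom_words" "b \<in> hcomp i"
    then have **: "u @ (i, a + b) # v \<in> hom_words" "u @ (i, b) # v \<in> hom_words"
      by (auto simp: hcomp_add)
    show "sym_prod (u @ (i, a + b) # v) = sym_prod (u @ (i, a) # v) + sym_prod (u @ (i, b) # v)"
      unfolding sym_prod_eq_abs[OF *(1)] sym_prod_eq_abs[OF **(1)] sym_prod_eq_abs[OF **(2)]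
        abs_sym_add[OF keys_single_hom_words[OF *(1)] keys_single_hom_words[OF **(2)], symmetric]
      by (intro abs_sym_eqI rel * ** ) (use sym_relators.add[OF *] in \<open>simp add: algebra_simps\<close>) }
  { assume *: "u @ (i, a) # v \<in> hom_words"
    then have **: "u @ (i, c *\<^sub>C a) # v \<in> hom_words"
      by (auto simp: hcomp_scaleC)
    show "sym_prod (u @ (i, c *\<^sub>C a) # v) = c *\<^sub>C sym_prod (u @ (i, a) # v)"
      unfolding sym_prod_eq_abs[OF *] sym_prod_eq_abs[OF **]
        abs_sym_scaleC[OF keys_single_hom_words[OF *], symmetric]
      by (intro abs_sym_eqI rel * ** sym_relators.scale) }
  { assume *: "u @ (i, a) # (j, b) # v \<in> hom_words"
    then have **: "u @ (j, b) # (i, a) # v \<in> hom_words"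
      by auto
    show "sym_prod (u @ (i, a) # (j, b) # v)
        = swap_sign i j *\<^sub>C sym_prod (u @ (j, b) # (i, a) # v)"
      unfolding sym_prod_eq_abs[OF *] sym_prod_eq_abs[OF **]
        abs_sym_scaleC[OF keys_single_hom_words[OF **], symmetric]
      by (intro abs_sym_eqI rel * ** sym_relators.swap) }
qed

lemma lookup_scaleC: "Poly_Mapping.lookup (c *\<^sub>C p) k = c *\<^sub>C Poly_Mapping.lookup p k"
  by (simp add: scaleC_poly_mapping.rep_eq)

definition free_extend :: "('k \<Rightarrow> 'b::complex_vector) \<Rightarrow> ('k \<Rightarrow>\<^sub>0 complex) \<Rightarrow> 'b"
  where "free_extend f p = (\<Sum>w\<in>Poly_Mapping.keys p. Poly_Mapping.lookup p w *\<^sub>C f w)"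

lemma free_extend_superset:
  "finite A \<Longrightarrow> Poly_Mapping.keys p \<subseteq> A \<Longrightarrow> free_extend f p = (\<Sum>w\<in>A. Poly_Mapping.lookup p w *\<^sub>C f w)"
  unfolding free_extend_def by (rule sum.mono_neutral_left) (auto simp: in_keys_iff)

lemma clinearI:
  assumes "\<And>x y. f (x + y) = f x + f y" and "\<And>c x. f (c *\<^sub>C x) = c *\<^sub>C f x"
  shows "clinear f"
  unfolding Vector_Spaces.linear_iff
  by (intro conjI allI complex_vector.vector_space_axioms assms)

lemma free_extend_linear: "clinear (free_extend f)"
proof (rule clinearI)
  fix p q :: "'a \<Rightarrow>\<^sub>0 complex" and c :: complex
  let ?A = "Poly_Mapping.keys p \<union> Poly_Mapping.keys q"
  have "Poly_Mapping.keys (p + q) \<subseteq> ?A" "Poly_Mapping.keys (c *\<^sub>C p) \<subseteq> ?A"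
    using keys_add[of p q] by (auto simp: in_keys_iff lookup_scaleC)
  then show "free_extend f (p + q) = free_extend f p + free_extend f q"
    and "free_extend f (c *\<^sub>C p) = c *\<^sub>C free_extend f p"
    by (simp_all add: free_extend_superset[of ?A] lookup_add lookup_scaleC scaleC_add_left
        sum.distrib complex_vector.scale_sum_right scaleC_complex_def)
qed

lemma free_extend_single: "free_extend f (Poly_Mapping.single w c) = c *\<^sub>C f w"
  by (cases "c = 0") (simp_all add: free_extend_def)

lemma free_extend_relators:
  assumes f: "koszul_multilinear f" and p: "p \<in> complex_vector.span sym_relators"
  shows "free_extend f p = 0"
proof -
  interpret F: Vector_Spaces.linear scaleC scaleC "free_extend f" by (rule free_extend_linear)
  show ?thesis
  proof (rule F.eq_0_on_span[OF _ p])
    fix r assume "r \<in> (sym_relators :: ((int \<times> 'a) list \<Rightarrow>\<^sub>0 complex) set)"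
    then show "free_extend f r = 0"
    proof cases
      case (add u i a v b)
      then show ?thesis using koszul_multilinearD(1)[OF f add(2,3)]
        by (simp add: F.diff free_extend_single scaleC_one)
    next
      case (scale u i a v c)
      then show ?thesis using koszul_multilinearD(2)[OF f scale(2)]
        by (simp add: F.diff free_extend_single scaleC_one F.scale)
    next
      case (swap u i a j b v)
      then show ?thesis using koszul_multilinearD(3)[OF f swap(2)]
        by (simp add: F.diff free_extend_single scaleC_one F.scale)
    qed
  qed
qed

text \<open>
  A representative supported on words is a linear combination of single words, which is shown by
  removing one key at a time.
\<close>

lemma sym_induct [case_names zero add scale prod]:
  fixes x :: "'a::graded_vector sym"
  assumes "P 0" and "\<And>x y. P x \<Longrightarrow> P y \<Longrightarrow> P (x + y)" and "\<And>c x. P x \<Longrightarrow> P (c *\<^sub>C x)"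
    and "\<And>w. w \<in> hom_words \<Longrightarrow> P (sym_prod w)"
  shows "P x"
proof -
  have "P (abs_sym p)" if "finite A" "A \<subseteq> hom_words" "Poly_Mapping.keys p \<subseteq> A"
    for A and p :: "(int \<times> 'a) list \<Rightarrow>\<^sub>0 complex"
    using that
  proof (induction A arbitrary: p)
    case empty
    then show ?case using assms(1) by (simp add: zero_sym_def)
  next
    case (insert w A)
    let ?s = "Poly_Mapping.single w 1 :: (int \<times> 'a) list \<Rightarrow>\<^sub>0 complex"
    define q where "q = p - Poly_Mapping.lookup p w *\<^sub>C ?s"
    have w: "w \<in> hom_words"
      using insert.prems by simp
    have "Poly_Mapping.lookup q k = (if k = w then 0 else Poly_Mapping.lookup p k)" for k
      by (simp add: q_def lookup_minus lookup_scaleC lookup_single scaleC_complex_def)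
    then have q: "Poly_Mapping.keys q \<subseteq> A"
      using insert.prems by (auto simp: in_keys_iff split: if_splits)
    have p: "p = q + Poly_Mapping.lookup p w *\<^sub>C ?s"
      by (simp add: q_def)
    have "abs_sym p = abs_sym q + Poly_Mapping.lookup p w *\<^sub>C sym_prod w"
      using q insert.prems keys_single_hom_words[OF w, of 1]
      by (subst p) (simp add: abs_sym_add abs_sym_scaleC sym_prod_eq_abs keys_hom_words_closed w)
    then show ?case
      using insert q w by (auto intro!: assms)
  qed
  from this[OF finite_keys _ subset_refl] have "P (abs_sym p)"
    if "Poly_Mapping.keys p \<subseteq> hom_words" for p :: "(int \<times> 'a) list \<Rightarrow>\<^sub>0 complex"
    using that by blast
  moreover have "sym_rel (rep_sym x) (rep_sym x)"
    by (rule Quotient_rep_reflp[OF Quotient_sym])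
  ultimately have "P (abs_sym (rep_sym x))"
    by (simp add: sym_rel_def)
  then show ?thesis
    by (simp add: Quotient_abs_rep[OF Quotient_sym])
qed

lemma clinear_eqI:
  fixes F G :: "'a::graded_vector sym \<Rightarrow> 'b::complex_vector"
  assumes F: "clinear F" and G: "clinear G"
    and eq: "\<And>w. w \<in> hom_words \<Longrightarrow> F (sym_prod w) = G (sym_prod w)"
  shows "F = G"
proof
  interpret F: Vector_Spaces.linear scaleC scaleC F by (rule F)
  interpret G: Vector_Spaces.linear scaleC scaleC G by (rule G)
  show "F x = G x" for x
    by (induction x rule: sym_induct) (simp_all add: F.add G.add F.scale G.scale eq)
qed

text \<open>
  The linear extension to the free vector space vanishes on the relators, so its value
  does not depend on the representative of a class.
\<close>

lemma sym_extend_exists: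
  fixes f :: "(int \<times> 'a::graded_vector) list \<Rightarrow> 'b::complex_vector"
  assumes f: "koszul_multilinear f"
  shows "\<exists>F. clinear F \<and> (\<forall>w\<in>hom_words. F (sym_prod w) = f w)"
proof (intro exI conjI ballI)
  interpret F: Vector_Spaces.linear scaleC scaleC "free_extend f" by (rule free_extend_linear)
  have rel: "free_extend f p = free_extend f q" if "sym_rel p q" for p q
    using free_extend_relators[OF f, of "p - q"] that by (simp add: sym_rel_def F.diff)
  have abs: "free_extend f (rep_sym (abs_sym p)) = free_extend f p"
    if "Poly_Mapping.keys p \<subseteq> hom_words" for p
    by (rule rel, rule Quotient_rep_abs[OF Quotient_sym]) (simp add: sym_relI that)
  have keys: "Poly_Mapping.keys (rep_sym x) \<subseteq> hom_words" for x :: "'a sym"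
    using Quotient_rep_reflp[OF Quotient_sym, of x] by (simp add: sym_rel_def)
  have abs_rep: "abs_sym (rep_sym x) = x" for x :: "'a sym"
    by (rule Quotient_abs_rep[OF Quotient_sym])
  show "clinear (\<lambda>x. free_extend f (rep_sym x))"
  proof (rule clinearI)
    fix x y :: "'a sym" and c :: complex
    show "free_extend f (rep_sym (x + y)) = free_extend f (rep_sym x) + free_extend f (rep_sym y)"
      using abs[of "rep_sym x + rep_sym y"] keys[of x] keys[of y]
      by (simp add: abs_sym_add abs_rep F.add keys_hom_words_closed)
    show "free_extend f (rep_sym (c *\<^sub>C x)) = c *\<^sub>C free_extend f (rep_sym x)"
      using abs[of "c *\<^sub>C rep_sym x"] keys[of x]
      by (simp add: abs_sym_scaleC abs_rep F.scale keys_hom_words_closed)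
  qed
  show "free_extend f (rep_sym (sym_prod w)) = f w" if "w \<in> hom_words" for w
    using that
    by (simp add: sym_prod_eq_abs abs keys_single_hom_words free_extend_single scaleC_one)
qed

text \<open>
  Existence comes from the free vector space on words, uniqueness from the words spanning \<open>SV\<close>.
\<close>

lemma sym_extend:
  fixes f :: "(int \<times> 'a::graded_vector) list \<Rightarrow> 'b::complex_vector"
  assumes "koszul_multilinear f"
  shows clinear_sym_extend: "clinear (sym_extend f)"
    and sym_extend_prod: "w \<in> hom_words \<Longrightarrow> sym_extend f (sym_prod w) = f w"
proof -
  let ?P = "\<lambda>F. clinear F \<and> (\<forall>w\<in>hom_words. F (sym_prod w) = f w)"
  have "\<exists>!F. ?P F"
    using sym_extend_exists[OF assms] by (auto intro: clinear_eqI)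
  then have "?P (sym_extend f)"
    unfolding sym_extend_def by (rule theI')
  then show "clinear (sym_extend f)"
    and "w \<in> hom_words \<Longrightarrow> sym_extend f (sym_prod w) = f w" by auto
qed

section \<open>Koszul signs\<close>

lemma swap_sign_self_inverse: "swap_sign i j * swap_sign i j = 1"
  by (simp flip: power_int_mult_distrib)

lemma swap_sign_commute: "swap_sign i j = swap_sign j i"
  by (simp add: mult.commute)

lemma swap_sign_add_left: "swap_sign (i + k) j = swap_sign i j * swap_sign k j"
  by (simp add: distrib_right power_int_add)

lemma swap_sign_add_right: "swap_sign i (j + k) = swap_sign i j * swap_sign i k"
  by (simp add: distrib_left power_int_add)

text \<open>
  The part of the Koszul sign of \<open>A @ B\<close> that comes from inversions between \<open>A\<close> and \<open>B\<close>.
\<close>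

definition inversion_sign :: "int list \<Rightarrow> nat list \<Rightarrow> nat list \<Rightarrow> complex"
  where "inversion_sign ds A B =
    (\<Prod>x\<leftarrow>A. \<Prod>y\<leftarrow>B. if y < x then swap_sign (ds ! x) (ds ! y) else 1)"

lemma inversion_sign_append:
  "inversion_sign ds (A @ A') B = inversion_sign ds A B * inversion_sign ds A' B"
  "inversion_sign ds A (B @ B') = inversion_sign ds A B * inversion_sign ds A B'"
  by (simp add: inversion_sign_def, induction A) (simp_all add: inversion_sign_def)

lemma koszul_sign_Cons: "koszul_sign ds (x # B) = inversion_sign ds [x] B * koszul_sign ds B"
proof -
  have "(\<Prod>y\<leftarrow>filter (\<lambda>y. y < x) B. f y) = (\<Prod>y\<leftarrow>B. if y < x then f y else 1)"
    for f :: "nat \<Rightarrow> complex"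
    by (induction B) auto
  then show ?thesis
    by (simp add: inversion_sign_def)
qed

lemma koszul_sign_append:
  "koszul_sign ds (A @ B) = koszul_sign ds A * inversion_sign ds A B * koszul_sign ds B"
proof (induction A)
  case Nil
  then show ?case by (simp add: inversion_sign_def)
next
  case (Cons x A)
  then show ?case
    using inversion_sign_append(2)[of ds "[x]" A B] inversion_sign_append(1)[of ds "[x]" A B]
    by (simp only: append_Cons append_Nil koszul_sign_Cons) simp
qed

text \<open>
  Each pair in \<open>A \<times> B\<close> is an inversion for exactly one of the two orders, so the two
  signs differ by the product of \<open>swap_sign\<close> over all pairs; that product is the sign of the total
  degrees, by bilinearity of the exponent.
\<close>

lemma inversion_sign_exchange:
  assumes "set A \<inter> set B = {}"
  shows "inversion_sign ds A B =
    swap_sign (\<Sum>x\<leftarrow>A. ds ! x) (\<Sum>y\<leftarrow>B. ds ! y) * inversion_sign ds B A"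
  using assms
proof (induction A)
  case Nil
  have "inversion_sign ds B [] = 1" by (induction B) (simp_all add: inversion_sign_def)
  then show ?case by (simp add: inversion_sign_def)
next
  case (Cons x A)
  have single: "inversion_sign ds [x] B = swap_sign (ds ! x) (\<Sum>y\<leftarrow>B. ds ! y) * inversion_sign ds B [x]"
    if "x \<notin> set B"
    using that
  proof (induction B)
    case Nil
    then show ?case by (simp add: inversion_sign_def)
  next
    case (Cons y B)
    then have IH: "inversion_sign ds [x] B = swap_sign (ds ! x) (\<Sum>y\<leftarrow>B. ds ! y) * inversion_sign ds B [x]"
      and "x \<noteq> y" by simp_all
    then have "inversion_sign ds [x] [y] = swap_sign (ds ! x) (ds ! y) * inversion_sign ds [y] [x]"
      by (auto simp: inversion_sign_def swap_sign_commute[of "ds ! x"] swap_sign_self_inverse)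
    with IH show ?case
      using inversion_sign_append(2)[of ds "[x]" "[y]" B] inversion_sign_append(1)[of ds "[y]" B "[x]"]
      by (simp add: swap_sign_add_right)
  qed
  have "x \<notin> set B" using Cons.prems by simp
  from single[OF this] Cons show ?case
    using inversion_sign_append(1)[of ds "[x]" A B] inversion_sign_append(2)[of ds B "[x]" A]
    by (simp add: swap_sign_add_left)
qed

lemma koszul_sign_exchange:
  assumes "set A \<inter> set B = {}"
  shows "koszul_sign ds (U @ A @ B @ V) =
    swap_sign (\<Sum>x\<leftarrow>A. ds ! x) (\<Sum>y\<leftarrow>B. ds ! y) * koszul_sign ds (U @ B @ A @ V)"
  using inversion_sign_exchange[OF assms, of ds]
  by (simp add: koszul_sign_append inversion_sign_append)

lemma koszul_sign_sorted: "sorted l \<Longrightarrow> koszul_sign ds l = 1"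
proof (induction l)
  case (Cons x l)
  then have "filter (\<lambda>y. y < x) l = []" by (auto simp: filter_empty_conv)
  with Cons show ?case by simp
qed simp

text \<open>
  Relabelling by the transposition of two neighbouring numbers preserves the relative order of every
  other pair, and the degrees move along.  So the only inversion that can appear or disappear is
  the pair of the two transposed positions.
\<close>

lemma koszul_sign_transpose:
  assumes ds': "\<And>k. ds' ! transpose p (Suc p) k = ds ! k" and "distinct l"
  shows "koszul_sign ds' (map (transpose p (Suc p)) l) =
    (if p \<in> set l \<and> Suc p \<in> set l then swap_sign (ds ! p) (ds ! Suc p) else 1) * koszul_sign ds l"
  using \<open>distinct l\<close>
proof (induction l)
  case Nil
  then show ?case by simp
next
  case (Cons x l)
  let ?\<tau> = "transpose p (Suc p)" and ?\<epsilon> = "swap_sign (ds ! p) (ds ! Suc p)"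
  (* The inversions of x with a list m: the pair of x and its image, if m contains the image,
     is an inversion before or after relabelling, but not both times. *)
  have inv: "inversion_sign ds' [?\<tau> x] (map ?\<tau> m) =
    (if x = p \<and> Suc p \<in> set m \<or> x = Suc p \<and> p \<in> set m then ?\<epsilon> else 1) * inversion_sign ds [x] m"
    if "distinct (x # m)" for m
    using that
  proof (induction m)
    case Nil
    then show ?case by (simp add: inversion_sign_def)
  next
    case (Cons y m)
    have "?\<tau> y < ?\<tau> x \<longleftrightarrow> (if {x, y} = {p, Suc p} then \<not> y < x else y < x)"
      using Cons.prems by (auto simp: transpose_def doubleton_eq_iff)
    then have y: "inversion_sign ds' [?\<tau> x] [?\<tau> y] =
        (if x = p \<and> y = Suc p \<or> x = Suc p \<and> y = p then ?\<epsilon> else 1) * inversion_sign ds [x] [y]"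
      by (auto simp: inversion_sign_def ds' doubleton_eq_iff swap_sign_self_inverse
          swap_sign_commute[of "ds ! Suc p"])
    show ?case
      using Cons y inversion_sign_append(2)[of ds "[x]" "[y]" m]
        inversion_sign_append(2)[of ds' "[?\<tau> x]" "[?\<tau> y]" "map ?\<tau> m"]
      by auto
  qed
  from Cons.prems Cons.IH inv[OF Cons.prems] show ?case
    by (auto simp: koszul_sign_Cons simp del: koszul_sign.simps(2))
qed

text \<open>
  Neighbour exchanges generate all rearrangements: move the required first element to the front, then
  rearrange the rest.
\<close>

lemma adjacent_exchange_invariant:
  assumes "mset xs = mset ys"
    and "\<And>u a b v. mset (u @ a # b # v) = mset xs \<Longrightarrow> f (u @ a # b # v) = f (u @ b # a # v)"
  shows "f xs = f ys"
  using assms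
proof (induction xs arbitrary: ys f)
  case Nil
  from Nil(1) have "ys = []" by simp
  then show ?case by simp
next
  case (Cons x xs)
  then have "x \<in> set ys"
    by (metis list.set_intros(1) set_mset_mset)
  then obtain y1 y2 where ys: "ys = y1 @ x # y2"
    by (meson split_list)
  have front: "mset (y1 @ x # y2) = mset (x # xs) \<Longrightarrow> f (y1 @ x # y2) = f (x # y1 @ y2)"
  proof (induction y1 arbitrary: y2 rule: rev_induct)
    case (snoc b u)
    then show ?case using Cons.prems(2)[of u b x y2] by simp
  qed simp
  have "f (x # xs) = f (x # y1 @ y2)"
    by (rule Cons.IH[where f = "\<lambda>l. f (x # l)"])
      (use Cons.prems(1) Cons.prems(2)[of "x # _"] ys in simp_all)
  with front Cons.prems(1) ys show ?case by simp
qed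

section \<open>Ordered set partitions\<close>

text \<open>
  A listing of the blocks of a set partition of \<open>{..<n}\<close>, and of the elements of each block, in
  arbitrary order.
\<close>

definition ordered_partition :: "nat \<Rightarrow> nat list list \<Rightarrow> bool"
  where "ordered_partition n L \<longleftrightarrow> distinct (concat L) \<and> set (concat L) = {..<n} \<and> [] \<notin> set L"

lemma ordered_partition_mset:
  assumes "mset L = mset L'"
  shows "ordered_partition n L \<longleftrightarrow> ordered_partition n L'"
proof -
  have "mset (concat L) = mset (concat L')"
    by (metis assms mset_concat mset_map sum_mset_sum_list)
  then show ?thesis
    unfolding ordered_partition_def
    by (metis assms mset_eq_imp_distinct_iff mset_eq_setD)
qed

lemma ordered_partition_mset_block:
  assumes "mset l = mset l'"
  shows "ordered_partition n (U @ l # V) \<longleftrightarrow> ordered_partition n (U @ l' # V)"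
proof -
  have "mset (concat (U @ l # V)) = mset (concat (U @ l' # V))"
    using assms by simp
  moreover have "l = [] \<longleftrightarrow> l' = []"
    using assms by auto
  ultimately show ?thesis
    unfolding ordered_partition_def
    by (metis Un_iff insert_iff list.simps(15) mset_eq_imp_distinct_iff mset_eq_setD set_append)
qed

lemma partition_on_ordered_partition:
  assumes "ordered_partition n L"
  shows "partition_on {..<n} (set ` set L)" and "distinct (map set L)"
proof -
  have disj: "\<And>l m. l \<in> set L \<Longrightarrow> m \<in> set L \<Longrightarrow> l \<noteq> m \<Longrightarrow> set l \<inter> set m = {}"
    and ne: "[] \<notin> set L" and dist: "distinct L"
    using assms unfolding ordered_partition_def distinct_concat_iff
    by (auto simp: removeAll_id)
  show "partition_on {..<n} (set ` set L)"
    using assms disj unfolding ordered_partition_def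
    by (intro partition_onI) (auto simp: disjnt_def)
  have "inj_on set (set L)"
    using disj ne by (intro inj_onI) (metis inf.idem set_empty)
  then show "distinct (map set L)"
    using dist by (simp add: distinct_map)
qed

lemma finite_block:
  fixes \<pi> :: "nat set set"
  assumes "partition_on {..<n} \<pi>" and "B \<in> \<pi>"
  shows "finite B" and "B \<noteq> {}"
proof -
  have "B \<subseteq> {..<n}"
    using assms partition_onD1 by blast
  then show "finite B"
    by (rule finite_subset) simp
  show "B \<noteq> {}"
    using assms partition_onD3 by blast
qed

text \<open>
  The locale \<open>folding_insort_key\<close> speaks of the sorting function of an explicit order; this
  lemma returns to the one of the type class.
\<close>

lemma linorder_sorted_key_list_of_set:
  "linorder.sorted_key_list_of_set (\<le>) = sorted_key_list_of_set"
  by (intro ext) (simp only: linorder_class.sorted_key_list_of_set_def linorder_class.insort_key_def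
      linorder.sorted_key_list_of_set_def[OF linorder_class.linorder_axioms]
      linorder.insort_key_def[OF linorder_class.linorder_axioms])

lemma sorted_blocks:
  fixes \<pi> :: "nat set set"
  assumes \<pi>: "partition_on {..<n} \<pi>"
  shows "set (sorted_key_list_of_set Min \<pi>) = \<pi>" and "distinct (sorted_key_list_of_set Min \<pi>)"
proof -
  have fin: "finite \<pi>"
    using \<pi> by (rule finite_elements[rotated]) simp
  note B = finite_block[OF \<pi>]
  have "inj_on Min \<pi>"
  proof (rule inj_onI)
    fix B C assume "B \<in> \<pi>" "C \<in> \<pi>" "Min B = Min C"
    then have "Min B \<in> B \<inter> C"
      using B Min_in by (metis IntI)
    then show "B = C"
      using partition_onD2[OF \<pi>] \<open>B \<in> \<pi>\<close> \<open>C \<in> \<pi>\<close> by (auto simp: disjoint_def)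
  qed
  then interpret folding_insort_key "(\<le>)" "(<)" \<pi> Min
    by unfold_locales
  show "set (sorted_key_list_of_set Min \<pi>) = \<pi>" and "distinct (sorted_key_list_of_set Min \<pi>)"
    using set_sorted_key_list_of_set[OF subset_refl fin]
      distinct_sorted_key_list_of_set[of \<pi>]
    by (simp_all add: distinct_map linorder_sorted_key_list_of_set)
qed

lemma ordered_partition_blocks:
  assumes \<pi>: "partition_on {..<n} \<pi>"
  shows "ordered_partition n (blocks \<pi>)" and "set ` set (blocks \<pi>) = \<pi>"
proof -
  note S = sorted_blocks[OF \<pi>]
  note B = finite_block[OF \<pi>]
  show sets: "set ` set (blocks \<pi>) = \<pi>"
    using B by (force simp: blocks_def S image_image)
  have "inj_on sorted_list_of_set \<pi>"
    using B by (metis inj_on_def set_sorted_list_of_set)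
  then have "distinct (blocks \<pi>)"
    using S by (simp add: blocks_def distinct_map)
  moreover have "[] \<notin> set (blocks \<pi>)"
  proof
    assume "[] \<in> set (blocks \<pi>)"
    then obtain C where "C \<in> \<pi>" "sorted_list_of_set C = []"
      by (auto simp: blocks_def S)
    with B show False by auto
  qed
  moreover have "\<Union> (set ` set (blocks \<pi>)) = {..<n}"
    using sets partition_onD1[OF \<pi>] by simp
  moreover have "distinct l" if "l \<in> set (blocks \<pi>)" for l
    using that by (auto simp: blocks_def)
  moreover have "set l \<inter> set m = {}" if "l \<in> set (blocks \<pi>)" "m \<in> set (blocks \<pi>)" "l \<noteq> m" for l m
  proof -
    from that obtain B C where "l = sorted_list_of_set B" "m = sorted_list_of_set C" "B \<in> \<pi>" "C \<in> \<pi>"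
      by (auto simp: blocks_def S)
    with that B partition_onD2[OF \<pi>] show ?thesis
      by (metis disjointD set_sorted_list_of_set)
  qed
  ultimately show "ordered_partition n (blocks \<pi>)"
    unfolding ordered_partition_def distinct_concat_iff by (auto simp: removeAll_id)
qed

text \<open>
  Sorting inside the blocks leaves only the order of the blocks undetermined.
\<close>

lemma mset_blocks:
  assumes "ordered_partition n L"
  shows "mset (map sort L) = mset (blocks (set ` set L))"
proof -
  note P = partition_on_ordered_partition[OF assms]
  have "distinct l" if "l \<in> set L" for l
    using assms that by (auto simp: ordered_partition_def distinct_concat_iff)
  then have "map sort L = map sorted_list_of_set (map set L)"
    by (simp add: sorted_list_of_set_sort_remdups distinct_remdups_id)
  moreover have "mset (map set L) = mset (sorted_key_list_of_set Min (set ` set L))"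
    using P(2) sorted_blocks[OF P(1)] by (subst set_eq_iff_mset_eq_distinct[symmetric]) auto
  ultimately show ?thesis
    unfolding blocks_def by (metis mset_map)
qed

section \<open>Coalgebra maps with components of degree zero\<close>

lemma subword_append: "subword w (x @ p # y) = subword w x @ w ! p # subword w y"
  by (simp add: subword_def)

lemma subword_hom_words:
  "w \<in> hom_words \<Longrightarrow> l \<noteq> [] \<Longrightarrow> set l \<subseteq> {..<length w} \<Longrightarrow> subword w l \<in> hom_words"
  unfolding hom_words_def subword_def by (fastforce dest: nth_mem)

lemma word_degree_subword:
  "set l \<subseteq> {..<length w} \<Longrightarrow> word_degree (subword w l) = (\<Sum>x\<leftarrow>l. map fst w ! x)"
  by (induction l) (simp_all add: word_degree_def subword_def)

text \<open>
  The data from which \<open>coalg_map\<close> builds a coalgebra map.  Degree zero makes the values on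
  blocks homogeneous, so that they can be multiplied in the target, and it makes the
  Koszul signs of blocks and of their images agree.
\<close>

locale degree_zero_components =
  fixes F :: "'a::graded_vector sym \<Rightarrow> 'b::graded_vector"
  assumes F_linear: "clinear F"
    and F_degree: "w \<in> hom_words \<Longrightarrow> F (sym_prod w) \<in> hcomp (word_degree w)"
begin

sublocale F: Vector_Spaces.linear scaleC scaleC F
  by (rule F_linear)

definition block_letter :: "(int \<times> 'a) list \<Rightarrow> nat list \<Rightarrow> int \<times> 'b"
  where "block_letter w l = (word_degree (subword w l), F (sym_prod (subword w l)))"

lemma coalg_term_block_letter:
  "coalg_term F w L = koszul_sign (map fst w) (concat L) *\<^sub>C sym_prod (map (block_letter w) L)"
  by (simp add: coalg_term_def block_letter_def[abs_def])

lemma block_letter_hom: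
  assumes "w \<in> hom_words" and "ordered_partition (length w) L" and "(k, x) \<in> block_letter w ` set L"
  shows "x \<in> hcomp k"
proof -
  from assms(3) obtain l where "l \<in> set L" and kx: "block_letter w l = (k, x)"
    by auto
  then have "l \<noteq> []" "set l \<subseteq> {..<length w}"
    using assms(2) by (auto simp: ordered_partition_def)
  from F_degree[OF subword_hom_words[OF assms(1) this]] kx show ?thesis
    by (auto simp: block_letter_def)
qed

text \<open>
  Exchanging neighbouring blocks \<open>A\<close>, \<open>B\<close> changes both the sign of the listing and the product in the
  target by the \<open>swap_sign\<close> of their total degrees; the two signs cancel.
\<close>

lemma coalg_term_mset_blocks:
  assumes w: "w \<in> hom_words" and L: "ordered_partition (length w) L" and eq: "mset L = mset L'"
  shows "coalg_term F w L = coalg_term F w L'"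
  using eq
proof (rule adjacent_exchange_invariant)
  fix U A B V assume "mset (U @ A # B # V) = mset L"
  with L have P: "ordered_partition (length w) (U @ A # B # V)"
    using ordered_partition_mset by blast
  then have AB: "set A \<subseteq> {..<length w}" "set B \<subseteq> {..<length w}" "set A \<inter> set B = {}"
    by (auto simp: ordered_partition_def)
  have hom: "map (block_letter w) U @ block_letter w A # block_letter w B # map (block_letter w) V \<in> hom_words"
    using block_letter_hom[OF w P] by (auto simp: hom_words_def)
  show "coalg_term F w (U @ A # B # V) = coalg_term F w (U @ B # A # V)"
    using koszul_sign_exchange[OF AB(3), of "map fst w" "concat U" "concat V"]
      koszul_multilinearD(3)[OF sym_prod_koszul_multilinear hom[unfolded block_letter_def]]
    by (simp add: coalg_term_def word_degree_subword AB scaleC_scaleC swap_sign_self_inverse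
        mult.assoc mult.left_commute scaleC_one)
qed

text \<open>
  Here the sign of the listing is cancelled by the sign that \<open>F\<close> picks up from the Koszul rule of
  its argument.
\<close>

lemma coalg_term_mset_block:
  assumes w: "w \<in> hom_words" and L: "ordered_partition (length w) (U @ l # V)" and eq: "mset l = mset l'"
  shows "coalg_term F w (U @ l # V) = coalg_term F w (U @ l' # V)"
  using eq
proof (rule adjacent_exchange_invariant[where f = "\<lambda>l. coalg_term F w (U @ l # V)"])
  fix x p q y assume "mset (x @ p # q # y) = mset l"
  with L have P: "ordered_partition (length w) (U @ (x @ p # q # y) # V)"
    using ordered_partition_mset_block by blast
  obtain i a j b where pq: "w ! p = (i, a)" "w ! q = (j, b)"
    by fastforce
  have bd: "p < length w" "q < length w" "p \<noteq> q"
    using P by (auto simp: ordered_partition_def)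
  have "subword w (x @ p # q # y) \<in> hom_words"
    using P by (intro subword_hom_words w) (auto simp: ordered_partition_def)
  then have hom: "subword w x @ (i, a) # (j, b) # subword w y \<in> hom_words"
    by (simp add: subword_def pq)
  have deg: "word_degree (subword w (x @ q # p # y)) = word_degree (subword w (x @ p # q # y))"
    by (simp add: word_degree_def subword_def)
  have F: "F (sym_prod (subword w (x @ p # q # y)))
      = swap_sign i j *\<^sub>C F (sym_prod (subword w (x @ q # p # y)))"
    using koszul_multilinearD(3)[OF sym_prod_koszul_multilinear hom]
    by (simp add: subword_def pq F.scale)
  have P': "ordered_partition (length w) (U @ (x @ q # p # y) # V)"
    using P ordered_partition_mset_block[of "x @ p # q # y" "x @ q # p # y"] by simp
  have hom': "map (block_letter w) U @ block_letter w (x @ q # p # y) # map (block_letter w) V \<in> hom_words"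
    using block_letter_hom[OF w P'] by (auto simp: hom_words_def)
  then have "sym_prod (map (block_letter w) (U @ (x @ p # q # y) # V))
      = swap_sign i j *\<^sub>C sym_prod (map (block_letter w) (U @ (x @ q # p # y) # V))"
    using koszul_multilinearD(2)[OF sym_prod_koszul_multilinear hom'[unfolded block_letter_def[of _ "x @ q # p # y"]]]
    by (simp add: block_letter_def[of _ "x @ p # q # y"] block_letter_def[of _ "x @ q # p # y"] F deg)
  moreover have "koszul_sign (map fst w) (concat (U @ (x @ p # q # y) # V))
      = swap_sign i j * koszul_sign (map fst w) (concat (U @ (x @ q # p # y) # V))"
    using koszul_sign_exchange[of "[p]" "[q]" "map fst w" "concat U @ x" "y @ concat V"] bd
    by (simp add: pq)
  ultimately show "coalg_term F w (U @ (x @ p # q # y) # V) = coalg_term F w (U @ (x @ q # p # y) # V)"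
    by (simp add: coalg_term_block_letter scaleC_scaleC swap_sign_self_inverse
        mult.assoc mult.left_commute)
qed

lemma coalg_term_sort_blocks:
  assumes w: "w \<in> hom_words" and L: "ordered_partition (length w) (U @ L)"
  shows "coalg_term F w (U @ L) = coalg_term F w (U @ map sort L) \<and> ordered_partition (length w) (U @ map sort L)"
  using L
proof (induction L arbitrary: U)
  case (Cons l L)
  then have "coalg_term F w (U @ l # L) = coalg_term F w (U @ sort l # L)"
    and P: "ordered_partition (length w) ((U @ [sort l]) @ L)"
    using coalg_term_mset_block[OF w Cons.prems, of "sort l"]
      ordered_partition_mset_block[of l "sort l" "length w" U L] by simp_all
  with Cons.IH[OF P] show ?case by simp
qed simp

text \<open>
  Relabelling positions does not respect the order of blocks by their minima; this lemma returns a
  relabelled listing to that order.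
\<close>

lemma coalg_term_blocks:
  assumes w: "w \<in> hom_words" and L: "ordered_partition (length w) L"
  shows "coalg_term F w L = coalg_term F w (blocks (set ` set L))"
  using coalg_term_sort_blocks[OF w, of "[]" L] coalg_term_mset_blocks[OF w _ mset_blocks[OF L]] L
  by simp

text \<open>
  The position of the distinguished letter lies in exactly one block, so this letter enters the summand
  through a single argument of \<open>F\<close>; \<open>k\<close>, \<open>U\<close>, \<open>x\<close>, \<open>y\<close>, \<open>V\<close> do not depend on the letter.
\<close>

lemma coalg_term_in_letter:
  assumes w: "u @ (i, a) # v \<in> hom_words" and L: "ordered_partition (Suc (length u + length v)) L"
  obtains k U x y V where
    "\<And>b. coalg_term F (u @ (i, b) # v) L
      = k *\<^sub>C sym_prod (U @ (word_degree x + i + word_degree y, F (sym_prod (x @ (i, b) # y))) # V)"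
    and "\<forall>(j, c)\<in>set U \<union> set V. c \<in> hcomp j" and "\<forall>(j, c)\<in>set x \<union> set y. c \<in> hcomp j"
proof -
  let ?w = "\<lambda>b. u @ (i, b) # v" and ?p = "length u"
  have "?p \<in> set (concat L)"
    using L by (simp add: ordered_partition_def)
  then obtain l where "l \<in> set L" "?p \<in> set l"
    by auto
  then obtain U x y V where split: "L = U @ (x @ ?p # y) # V"
    by (metis split_list)
  with L have notin: "\<forall>l\<in>set U. ?p \<notin> set l" "?p \<notin> set x" "?p \<notin> set y" "\<forall>l\<in>set V. ?p \<notin> set l"
    by (auto simp: ordered_partition_def)
  have nth: "?w b ! k = ?w a ! k" if "k \<noteq> ?p" for b k
    using that by (cases "k - ?p") (simp_all add: nth_append)
  have subw: "subword (?w b) l = subword (?w a) l" if "?p \<notin> set l" for b l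
    using that by (auto simp: subword_def intro!: nth)
  have letter: "block_letter (?w b) l = block_letter (?w a) l" if "?p \<notin> set l" for b l
    by (simp only: block_letter_def subw[OF that, of b])
  have L': "ordered_partition (length (?w a)) L"
    using L by simp
  show thesis
  proof (rule that[of "koszul_sign (map fst (?w a)) (concat L)" "map (block_letter (?w a)) U"
        "subword (?w a) x" "subword (?w a) y" "map (block_letter (?w a)) V"])
    show "\<forall>(j, c)\<in>set (map (block_letter (?w a)) U) \<union> set (map (block_letter (?w a)) V). c \<in> hcomp j"
      using block_letter_hom[OF w L'] by (auto simp: split)
    have "subword (?w a) (x @ ?p # y) \<in> hom_words"
      by (rule subword_hom_words[OF w]) (use L in \<open>auto simp: split ordered_partition_def\<close>)
    then show "\<forall>(j, c)\<in>set (subword (?w a) x) \<union> set (subword (?w a) y). c \<in> hcomp j"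
      by (auto simp: hom_words_def subword_def)
    fix b
    have outer: "map (block_letter (?w b)) U = map (block_letter (?w a)) U"
      "map (block_letter (?w b)) V = map (block_letter (?w a)) V"
      using notin by (auto intro!: letter)
    have "subword (?w b) (x @ ?p # y) = subword (?w a) x @ (i, b) # subword (?w a) y"
      by (simp add: subword_append subw[OF notin(2), of b] subw[OF notin(3), of b])
    then have inner: "block_letter (?w b) (x @ ?p # y)
        = (word_degree (subword (?w a) x) + i + word_degree (subword (?w a) y),
           F (sym_prod (subword (?w a) x @ (i, b) # subword (?w a) y)))"
      by (simp add: block_letter_def word_degree_def)
    have "map (block_letter (?w b)) L = map (block_letter (?w a)) U
          @ (word_degree (subword (?w a) x) + i + word_degree (subword (?w a) y),
             F (sym_prod (subword (?w a) x @ (i, b) # subword (?w a) y)))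
          # map (block_letter (?w a)) V"
      by (simp only: split map_append list.map outer inner)
    then show "coalg_term F (?w b) L = koszul_sign (map fst (?w a)) (concat L) *\<^sub>C
        sym_prod (map (block_letter (?w a)) U
          @ (word_degree (subword (?w a) x) + i + word_degree (subword (?w a) y),
             F (sym_prod (subword (?w a) x @ (i, b) # subword (?w a) y)))
          # map (block_letter (?w a)) V)"
      by (simp add: coalg_term_block_letter)
  qed
qed

text \<open>
  With letters and positions exchanged together, each block reads off the same subword as before, and
  only the sign of the listing changes.
\<close>

lemma coalg_term_transpose:
  fixes u v i a j b
  defines "w \<equiv> u @ (i, a) # (j, b) # v" and "w' \<equiv> u @ (j, b) # (i, a) # v"
    and "\<tau> \<equiv> transpose (length u) (Suc (length u))"
  assumes L: "ordered_partition (length w) L"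
  shows "coalg_term F w' (map (map \<tau>) L) = swap_sign i j *\<^sub>C coalg_term F w L"
proof -
  have letters: "w' ! \<tau> k = w ! k" and degs: "map fst w' ! \<tau> k = map fst w ! k" for k
    by (auto simp: w_def w'_def \<tau>_def transpose_def nth_append nth_Cons')
  have "subword w' (map \<tau> l) = subword w l" for l
    by (simp add: subword_def letters)
  then have letters_eq: "map (block_letter w') (map (map \<tau>) L) = map (block_letter w) L"
    by (simp add: block_letter_def)
  have sign_eq: "koszul_sign (map fst w') (concat (map (map \<tau>) L))
      = swap_sign i j * koszul_sign (map fst w) (concat L)"
    using koszul_sign_transpose[OF degs[unfolded \<tau>_def], of "concat L"] L
    by (auto simp: ordered_partition_def \<tau>_def w_def map_concat nth_append)
  show ?thesis
    by (simp only: coalg_term_block_letter letters_eq sign_eq scaleC_scaleC)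
qed

text \<open>
  Linearity holds summand by summand.  For the Koszul rule, the transposition of the
  two positions acts as an involution on set partitions and matches the summands of the two words.
\<close>

lemma coalg_terms_koszul_multilinear:
  "koszul_multilinear (\<lambda>w. \<Sum>\<pi> | partition_on {..<length w} \<pi>. coalg_term F w (blocks \<pi>))"
proof (rule koszul_multilinearI)
  fix u v :: "(int \<times> 'a) list" and i j :: int and a b :: 'a and c :: complex
  note sum = koszul_multilinearD(1)[OF sym_prod_koszul_multilinear]
    and scale = koszul_multilinearD(2)[OF sym_prod_koszul_multilinear]
  { assume w: "u @ (i, a) # v \<in> hom_words" and b: "b \<in> hcomp i"
    have "coalg_term F (u @ (i, a + b) # v) L = coalg_term F (u @ (i, a) # v) L + coalg_term F (u @ (i, b) # v) L"
      if L: "ordered_partition (Suc (length u + length v)) L" for L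
    proof -
      obtain k U x y V where
        eq: "\<And>b. coalg_term F (u @ (i, b) # v) L
          = k *\<^sub>C sym_prod (U @ (word_degree x + i + word_degree y, F (sym_prod (x @ (i, b) # y))) # V)"
        and UV: "\<forall>(j, c)\<in>set U \<union> set V. c \<in> hcomp j" and xy: "\<forall>(j, c)\<in>set x \<union> set y. c \<in> hcomp j"
        using coalg_term_in_letter[OF w L] by blast
      have hom: "x @ (i, d) # y \<in> hom_words" if "d \<in> hcomp i" for d
        using that xy by auto
      then have "F (sym_prod (x @ (i, d) # y)) \<in> hcomp (word_degree x + i + word_degree y)" if "d \<in> hcomp i" for d
        using F_degree[OF hom[OF that]] by (simp add: word_degree_def add.assoc)
      moreover have "a \<in> hcomp i" using w by simp
      ultimately show ?thesis
        using b UV unfolding eq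
        by (subst sum[OF hom[OF \<open>a \<in> hcomp i\<close>] b]) (auto simp: F.add sum simp flip: scaleC_add_right)
    qed
    then show "(\<Sum>\<pi> | partition_on {..<length (u @ (i, a + b) # v)} \<pi>. coalg_term F (u @ (i, a + b) # v) (blocks \<pi>))
      = (\<Sum>\<pi> | partition_on {..<length (u @ (i, a) # v)} \<pi>. coalg_term F (u @ (i, a) # v) (blocks \<pi>))
      + (\<Sum>\<pi> | partition_on {..<length (u @ (i, b) # v)} \<pi>. coalg_term F (u @ (i, b) # v) (blocks \<pi>))"
      by (simp add: ordered_partition_blocks flip: sum.distrib) }
  { assume w: "u @ (i, a) # v \<in> hom_words"
    have "coalg_term F (u @ (i, c *\<^sub>C a) # v) L = c *\<^sub>C coalg_term F (u @ (i, a) # v) L"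
      if L: "ordered_partition (Suc (length u + length v)) L" for L
    proof -
      obtain k U x y V where
        eq: "\<And>b. coalg_term F (u @ (i, b) # v) L
          = k *\<^sub>C sym_prod (U @ (word_degree x + i + word_degree y, F (sym_prod (x @ (i, b) # y))) # V)"
        and UV: "\<forall>(j, c)\<in>set U \<union> set V. c \<in> hcomp j" and xy: "\<forall>(j, c)\<in>set x \<union> set y. c \<in> hcomp j"
        using coalg_term_in_letter[OF w L] by blast
      have hom: "x @ (i, a) # y \<in> hom_words"
        using w xy by auto
      then have "F (sym_prod (x @ (i, a) # y)) \<in> hcomp (word_degree x + i + word_degree y)"
        using F_degree[OF hom] by (simp add: word_degree_def add.assoc)
      then show ?thesis
        using UV unfolding eq
        by (subst scale[OF hom]) (auto simp: F.scale scale scaleC_scaleC mult.commute)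
    qed
    then show "(\<Sum>\<pi> | partition_on {..<length (u @ (i, c *\<^sub>C a) # v)} \<pi>. coalg_term F (u @ (i, c *\<^sub>C a) # v) (blocks \<pi>))
      = c *\<^sub>C (\<Sum>\<pi> | partition_on {..<length (u @ (i, a) # v)} \<pi>. coalg_term F (u @ (i, a) # v) (blocks \<pi>))"
      by (simp add: ordered_partition_blocks complex_vector.scale_sum_right) }
  { let ?w = "u @ (i, a) # (j, b) # v" and ?w' = "u @ (j, b) # (i, a) # v"
      and ?\<tau> = "transpose (length u) (Suc (length u))"
    assume w: "?w \<in> hom_words"
    then have w': "?w' \<in> hom_words" by auto
    let ?n = "length ?w"
    have \<tau>: "?\<tau> ` {..<?n} = {..<?n}"
      by (rule transpose_image_eq) simp
    have part: "partition_on {..<?n} ((`) ?\<tau> ` \<pi>)" if \<pi>: "partition_on {..<?n} \<pi>" for \<pi>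
    proof -
      have "partition_on (?\<tau> ` {..<?n}) ((`) ?\<tau> ` \<pi> - {{}})"
        by (rule partition_on_inj_image[OF \<pi>]) simp
      moreover have "(`) ?\<tau> ` \<pi> - {{}} = (`) ?\<tau> ` \<pi>"
        using partition_onD3[OF \<pi>] by auto
      ultimately show ?thesis by (simp only: \<tau>)
    qed
    have invol: "(`) ?\<tau> ` (`) ?\<tau> ` \<pi> = \<pi>" for \<pi>
      by (simp add: image_image)
    have "coalg_term F ?w' (blocks ((`) ?\<tau> ` \<pi>)) = swap_sign i j *\<^sub>C coalg_term F ?w (blocks \<pi>)"
      if \<pi>: "partition_on {..<?n} \<pi>" for \<pi>
    proof -
      note P = ordered_partition_blocks[OF \<pi>]
      have "ordered_partition ?n (map (map ?\<tau>) (blocks \<pi>))"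
        using P(1) \<tau> unfolding ordered_partition_def
        by (auto simp: distinct_map simp flip: map_concat set_concat)
      then have "coalg_term F ?w' (map (map ?\<tau>) (blocks \<pi>))
          = coalg_term F ?w' (blocks (set ` set (map (map ?\<tau>) (blocks \<pi>))))"
        by (intro coalg_term_blocks w') simp
      also have "set ` set (map (map ?\<tau>) (blocks \<pi>)) = (`) ?\<tau> ` set ` set (blocks \<pi>)"
        by (simp add: image_image)
      finally show ?thesis
        using coalg_term_transpose[OF P(1)] P(2) by simp
    qed
    then have "swap_sign i j *\<^sub>C (\<Sum>\<pi> | partition_on {..<?n} \<pi>. coalg_term F ?w (blocks \<pi>))
        = (\<Sum>\<pi> | partition_on {..<?n} \<pi>. coalg_term F ?w' (blocks ((`) ?\<tau> ` \<pi>)))"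
      by (simp add: complex_vector.scale_sum_right)
    also have "\<dots> = (\<Sum>\<pi> | partition_on {..<?n} \<pi>. coalg_term F ?w' (blocks \<pi>))"
      by (rule sum.reindex_bij_witness[where i = "(`) ((`) ?\<tau>)" and j = "(`) ((`) ?\<tau>)"])
        (use part in \<open>auto simp: invol\<close>)
    (* The sign is its own inverse, so it can be moved to the other side. *)
    finally have "swap_sign i j *\<^sub>C swap_sign i j *\<^sub>C (\<Sum>\<pi> | partition_on {..<?n} \<pi>. coalg_term F ?w (blocks \<pi>))
        = swap_sign i j *\<^sub>C (\<Sum>\<pi> | partition_on {..<?n} \<pi>. coalg_term F ?w' (blocks \<pi>))"
      by simp
    then show "(\<Sum>\<pi> | partition_on {..<length ?w} \<pi>. coalg_term F ?w (blocks \<pi>))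
        = swap_sign i j *\<^sub>C (\<Sum>\<pi> | partition_on {..<length ?w'} \<pi>. coalg_term F ?w' (blocks \<pi>))"
      by (simp add: scaleC_scaleC swap_sign_self_inverse scaleC_one) }
qed

lemma clinear_coalg_map: "clinear (coalg_map F)"
  unfolding coalg_map_def by (rule clinear_sym_extend[OF coalg_terms_koszul_multilinear])

lemma coalg_map_prod:
  "w \<in> hom_words \<Longrightarrow> coalg_map F (sym_prod w)
    = (\<Sum>\<pi> | partition_on {..<length w} \<pi>. coalg_term F w (blocks \<pi>))"
  unfolding coalg_map_def by (rule sym_extend_prod[OF coalg_terms_koszul_multilinear])

end

section \<open>Coalgebra maps induced by linear maps\<close>

lemma sym_prod_zero_letter:
  assumes "(k, 0) \<in> set w"
  shows "sym_prod w = 0"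
proof (cases "w \<in> hom_words")
  case True
  from assms obtain u v where w: "w = u @ (k, 0) # v"
    by (meson split_list)
  show ?thesis
    using koszul_multilinearD(2)[OF sym_prod_koszul_multilinear True[unfolded w], of 0] w by simp
qed (rule sym_prod_eq_0)

locale degree_zero_map =
  fixes f :: "'a::graded_vector \<Rightarrow> 'b::graded_vector"
  assumes f_linear: "clinear f"
    and f_degree: "a \<in> hcomp i \<Longrightarrow> f a \<in> hcomp i"
begin

sublocale f: Vector_Spaces.linear scaleC scaleC f
  by (rule f_linear)

definition component :: "'a sym \<Rightarrow> 'b"
  where "component = sym_extend (\<lambda>w. if length w = 1 then f (snd (hd w)) else 0)"

lemma component_koszul_multilinear:
  "koszul_multilinear (\<lambda>w. if length w = 1 then f (snd (hd w)) else 0)"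
  by (rule koszul_multilinearI) (auto simp: f.add f.scale)

lemma component_prod:
  "w \<in> hom_words \<Longrightarrow> component (sym_prod w) = (if length w = 1 then f (snd (hd w)) else 0)"
  unfolding component_def by (rule sym_extend_prod[OF component_koszul_multilinear])

sublocale component: degree_zero_components component
proof (rule degree_zero_components.intro)
  show "clinear component"
    unfolding component_def by (rule clinear_sym_extend[OF component_koszul_multilinear])
  fix w :: "(int \<times> 'a) list" assume w: "w \<in> hom_words"
  show "component (sym_prod w) \<in> hcomp (word_degree w)"
  proof (cases "length w = 1")
    case True
    then obtain i a where "w = [(i, a)]"
      by (metis One_nat_def length_0_conv length_Suc_conv surj_pair)
    with w component_prod[OF w] show ?thesis
      by (simp add: hom_words_def word_degree_def f_degree)
  qed (simp add: component_prod[OF w] hcomp_zero)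
qed

lemma linear_coalg_map_component: "linear_coalg_map f = coalg_map component"
  by (simp add: linear_coalg_map_def component_def)

lemma clinear_linear_coalg_map: "clinear (linear_coalg_map f)"
  unfolding linear_coalg_map_component by (rule component.clinear_coalg_map)

lemma map_letters_hom_words: "w \<in> hom_words \<Longrightarrow> map (map_prod id f) w \<in> hom_words"
  using f_degree by (fastforce simp: hom_words_def)

text \<open>
  A block with more than one element contributes a zero letter, so only the partition into singletons
  survives.  Listing its blocks in increasing order gives the sign \<open>1\<close>.
\<close>

lemma linear_coalg_map_prod:
  assumes w: "w \<in> hom_words"
  shows "linear_coalg_map f (sym_prod w) = sym_prod (map (map_prod id f) w)"
proof -
  let ?n = "length w"
  let ?singletons = "(\<lambda>k. {k}) ` {..<?n}" and ?L = "map (\<lambda>k. [k]) [0..<?n]"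
  have vanish: "coalg_term component w (blocks \<pi>) = 0"
    if \<pi>: "partition_on {..<?n} \<pi>" and ne: "\<pi> \<noteq> ?singletons" for \<pi>
  proof -
    note P = ordered_partition_blocks[OF \<pi>]
    have "\<exists>l\<in>set (blocks \<pi>). length l \<noteq> 1"
    proof (rule ccontr)
      assume "\<not> ?thesis"
      then have sing: "\<exists>k. B = {k}" if "B \<in> set ` set (blocks \<pi>)" for B
        using that by (auto simp: length_Suc_conv)
      have "\<pi> = (\<lambda>k. {k}) ` \<Union>\<pi>"
      proof (intro set_eqI iffI)
        fix B assume "B \<in> \<pi>"
        with sing[unfolded P(2)] obtain k where "B = {k}" by blast
        with \<open>B \<in> \<pi>\<close> show "B \<in> (\<lambda>k. {k}) ` \<Union>\<pi>" by blast
      next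
        fix B assume "B \<in> (\<lambda>k. {k}) ` \<Union>\<pi>"
        then obtain k C where "B = {k}" "k \<in> C" "C \<in> \<pi>" by blast
        with sing[unfolded P(2), of C] show "B \<in> \<pi>" by auto
      qed
      then show False
        using ne partition_onD1[OF \<pi>] by simp
    qed
    then obtain l where l: "l \<in> set (blocks \<pi>)" "length l \<noteq> 1" by blast
    then have "subword w l \<in> hom_words"
      using P(1) by (intro subword_hom_words[OF w]) (auto simp: ordered_partition_def)
    then have "component (sym_prod (subword w l)) = 0"
      using l by (simp add: component_prod subword_def)
    then have "(word_degree (subword w l), 0) \<in> set (map (component.block_letter w) (blocks \<pi>))"
      using l by (force simp: component.block_letter_def)
    then show ?thesis
      by (simp add: component.coalg_term_block_letter sym_prod_zero_letter)
  qed
  have concat: "concat ?L = [0..<?n]"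
    by (simp add: concat_map_singleton)
  have P: "partition_on {..<?n} ?singletons"
    by (rule partition_on_singletons)
  have "linear_coalg_map f (sym_prod w)
      = (\<Sum>\<pi> | partition_on {..<?n} \<pi>. coalg_term component w (blocks \<pi>))"
    unfolding linear_coalg_map_component by (rule component.coalg_map_prod[OF w])
  also have "\<dots> = (\<Sum>\<pi>\<in>{?singletons}. coalg_term component w (blocks \<pi>))"
    by (rule sum.mono_neutral_right) (use P vanish in \<open>auto simp: finitely_many_partition_on\<close>)
  also have "\<dots> = coalg_term component w (blocks (set ` set ?L))"
    by (simp add: image_image atLeast0LessThan)
  also have "\<dots> = coalg_term component w ?L"
    by (rule component.coalg_term_blocks[symmetric, OF w])
      (auto simp: ordered_partition_def concat simp del: set_concat)
  also have "\<dots> = sym_prod (map (component.block_letter w) ?L)"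
    by (simp only: component.coalg_term_block_letter concat) (simp add: koszul_sign_sorted scaleC_one)
  also have "map (component.block_letter w) ?L = map (\<lambda>k. map_prod id f (w ! k)) [0..<?n]"
  proof -
    have "component.block_letter w [k] = map_prod id f (w ! k)" if "k < ?n" for k
      using subword_hom_words[OF w, of "[k]"] that
      by (cases "w ! k") (simp add: component.block_letter_def component_prod subword_def word_degree_def)
    then show ?thesis by simp
  qed
  also have "\<dots> = map (map_prod id f) w"
    by (rule nth_equalityI) simp_all
  finally show ?thesis .
qed

text \<open>
  If \<open>f\<close> intertwines the components, then it carries the summand of each set partition to the summand of
  the same set partition, with the same sign because \<open>f\<close> preserves degrees.
\<close>

lemma linear_coalg_map_natural:
  assumes F: "degree_zero_components F" and G: "degree_zero_components G"
    and FG: "\<And>w. w \<in> hom_words \<Longrightarrow> G (sym_prod (map (map_prod id f) w)) = f (F (sym_prod w))"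
  shows "coalg_map G \<circ> linear_coalg_map f = linear_coalg_map f \<circ> coalg_map F"
proof (rule clinear_eqI)
  interpret F: degree_zero_components F by (rule F)
  interpret G: degree_zero_components G by (rule G)
  interpret lin: Vector_Spaces.linear scaleC scaleC "linear_coalg_map f"
    by (rule clinear_linear_coalg_map)
  show "clinear (coalg_map G \<circ> linear_coalg_map f)" and "clinear (linear_coalg_map f \<circ> coalg_map F)"
    by (rule Vector_Spaces.linear_compose clinear_linear_coalg_map F.clinear_coalg_map G.clinear_coalg_map)+
  fix w :: "(int \<times> 'a) list" assume w: "w \<in> hom_words"
  let ?fw = "map (map_prod id f) w"
  have "coalg_term G ?fw L = linear_coalg_map f (coalg_term F w L)"
    if L: "ordered_partition (length w) L" for L
  proof -
    have "G.block_letter ?fw l = map_prod id f (F.block_letter w l)" if l: "l \<in> set L" for l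
    proof -
      have bd: "set l \<subseteq> {..<length w}" "l \<noteq> []"
        using L l by (auto simp: ordered_partition_def)
      then have "subword ?fw l = map (map_prod id f) (subword w l)"
        by (auto simp: subword_def)
      then show ?thesis
        using FG[OF subword_hom_words[OF w bd(2,1)]]
        by (simp add: F.block_letter_def G.block_letter_def word_degree_def)
    qed
    then have letters: "map (G.block_letter ?fw) L = map (map_prod id f) (map (F.block_letter w) L)"
      by simp
    have "L \<noteq> []"
      using L w by (auto simp: ordered_partition_def hom_words_def)
    then have "map (F.block_letter w) L \<in> hom_words"
      using F.block_letter_hom[OF w L] by (auto simp: hom_words_def) (metis image_eqI)
    then have "linear_coalg_map f (sym_prod (map (F.block_letter w) L))
        = sym_prod (map (G.block_letter ?fw) L)"
      unfolding letters by (rule linear_coalg_map_prod)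
    moreover have "map fst ?fw = map fst w" by simp
    ultimately show ?thesis
      by (simp only: F.coalg_term_block_letter G.coalg_term_block_letter lin.scale)
  qed
  then show "(coalg_map G \<circ> linear_coalg_map f) (sym_prod w)
      = (linear_coalg_map f \<circ> coalg_map F) (sym_prod w)"
    by (simp add: linear_coalg_map_prod w G.coalg_map_prod map_letters_hom_words F.coalg_map_prod
        lin.sum ordered_partition_blocks)
qed

end

lemma linear_coalg_map_compose:
  assumes "degree_zero_map f" and "degree_zero_map g"
  shows "linear_coalg_map g \<circ> linear_coalg_map f = linear_coalg_map (g \<circ> f)"
proof (rule clinear_eqI)
  interpret f: degree_zero_map f by fact
  interpret g: degree_zero_map g by fact
  interpret gf: degree_zero_map "g \<circ> f"
    by (rule degree_zero_map.intro)
      (simp_all add: Vector_Spaces.linear_compose[OF f.f_linear g.f_linear] f.f_degree g.f_degree)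
  show "clinear (linear_coalg_map g \<circ> linear_coalg_map f)" and "clinear (linear_coalg_map (g \<circ> f))"
    by (rule Vector_Spaces.linear_compose f.clinear_linear_coalg_map g.clinear_linear_coalg_map
        gf.clinear_linear_coalg_map)+
  fix w :: "(int \<times> 'a) list" assume "w \<in> hom_words"
  then show "(linear_coalg_map g \<circ> linear_coalg_map f) (sym_prod w) = linear_coalg_map (g \<circ> f) (sym_prod w)"
    by (simp add: f.linear_coalg_map_prod g.linear_coalg_map_prod gf.linear_coalg_map_prod
        f.map_letters_hom_words map_prod.comp)
qed

section \<open>Products and total cumulants\<close>

abbreviation product_component :: "'a::graded_comm_algebra sym \<Rightarrow> 'a"
  where "product_component \<equiv> sym_extend (\<lambda>w. prod_list (map snd w))"

text \<open>
  The Koszul rule for words is graded commutativity of two neighbouring factors.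
\<close>

lemma product_koszul_multilinear:
  "koszul_multilinear (\<lambda>w :: (int \<times> 'a::graded_comm_algebra) list. prod_list (map snd w))"
proof (rule koszul_multilinearI)
  fix u v :: "(int \<times> 'a) list" and i j :: int and a b :: 'a
  assume "u @ (i, a) # (j, b) # v \<in> hom_words"
  then have "a * b = swap_sign i j *\<^sub>C (b * a)"
    by (intro graded_commute) simp_all
  then show "prod_list (map snd (u @ (i, a) # (j, b) # v))
      = swap_sign i j *\<^sub>C prod_list (map snd (u @ (j, b) # (i, a) # v))"
    by (simp add: mult_scaleC_left mult_scaleC_right flip: mult.assoc[of a b] mult.assoc[of b a])
qed (simp_all add: mult_scaleC_left mult_scaleC_right algebra_simps)

lemma product_component_prod:
  "w \<in> hom_words \<Longrightarrow> product_component (sym_prod w) = prod_list (map snd w)"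
  by (rule sym_extend_prod[OF product_koszul_multilinear])

lemma product_in_word_degree:
  fixes w :: "(int \<times> 'a::graded_comm_algebra) list"
  assumes "w \<in> hom_words"
  shows "prod_list (map snd w) \<in> hcomp (word_degree w)"
proof -
  have "w \<noteq> []" and "\<forall>(i, a)\<in>set w. a \<in> hcomp i"
    using assms by (auto simp: hom_words_def)
  then show ?thesis
    by (induction w rule: list_nonempty_induct) (auto simp: word_degree_def intro: mult_hcomp)
qed

lemma product_degree_zero_components:
  "degree_zero_components (product_component :: 'a::graded_comm_algebra sym \<Rightarrow> 'a)"
  by (rule degree_zero_components.intro)
    (simp_all add: clinear_sym_extend product_koszul_multilinear product_component_prod product_in_word_degree)

text \<open>
  An algebra homomorphism intertwines the components \<open>a\<^sub>1 \<odot> \<dots> \<odot> a\<^sub>n \<mapsto> a\<^sub>1 \<cdots> a\<^sub>n\<close>.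
\<close>

lemma mult_coalg_map_natural:
  fixes f :: "'a::graded_comm_algebra \<Rightarrow> 'b::graded_comm_algebra"
  assumes "degree_zero_map f" and one: "f 1 = 1" and mult: "\<And>a b. f (a * b) = f a * f b"
  shows "mult_coalg_map \<circ> linear_coalg_map f = linear_coalg_map f \<circ> mult_coalg_map"
  unfolding mult_coalg_map_def
proof (rule degree_zero_map.linear_coalg_map_natural[OF assms(1)
      product_degree_zero_components product_degree_zero_components])
  interpret degree_zero_map f by fact
  fix w :: "(int \<times> 'a) list" assume w: "w \<in> hom_words"
  have "prod_list (map (f \<circ> snd) w) = f (prod_list (map snd w))"
    by (induction w) (simp_all add: one mult)
  then show "product_component (sym_prod (map (map_prod id f) w)) = f (product_component (sym_prod w))"
    by (simp add: product_component_prod w map_letters_hom_words)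
qed

lemma total_cumulant_natural:
  assumes \<alpha>: "degree_zero_map \<alpha>" and e: "degree_zero_map e"
    and "\<alpha> 1 = 1" and "\<And>a b. \<alpha> (a * b) = \<alpha> a * \<alpha> b"
  shows "total_cumulant e \<circ> linear_coalg_map \<alpha> = total_cumulant (e \<circ> \<alpha>)"
proof -
  have "total_cumulant e \<circ> linear_coalg_map \<alpha>
      = inv mult_coalg_map \<circ> linear_coalg_map e \<circ> (mult_coalg_map \<circ> linear_coalg_map \<alpha>)"
    by (simp add: total_cumulant_def conj_mult_def comp_assoc)
  also have "\<dots> = inv mult_coalg_map \<circ> (linear_coalg_map e \<circ> linear_coalg_map \<alpha>) \<circ> mult_coalg_map"
    by (simp add: mult_coalg_map_natural[OF assms(1,3,4)] comp_assoc)
  finally show ?thesis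
    by (simp add: linear_coalg_map_compose[OF \<alpha> e] total_cumulant_def conj_mult_def)
qed

theorem proposition3p4:
  fixes dV :: "'v::graded_comm_algebra \<Rightarrow> 'v" and \<upsilon>V :: "complex \<Rightarrow> 'v" and eV :: "'v \<Rightarrow> complex"
    and dW :: "'w::graded_comm_algebra \<Rightarrow> 'w" and \<upsilon>W :: "complex \<Rightarrow> 'w" and eW :: "'w \<Rightarrow> complex"
    and \<alpha> :: "'v \<Rightarrow> 'w"
  assumes "homotopy_prob_space dV \<upsilon>V eV"
    and "homotopy_prob_space dW \<upsilon>W eW"
    and "homotopy_prob_morphism dV \<upsilon>V eV dW \<upsilon>W eW \<alpha>"
    and "\<And>a b. \<alpha> (a * b) = \<alpha> a * \<alpha> b"
  shows "total_cumulant eW \<circ> linear_coalg_map \<alpha> = total_cumulant eV"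
proof -
  interpret homotopy_prob_morphism dV \<upsilon>V eV dW \<upsilon>W eW \<alpha> by fact
  have "degree_zero_map \<alpha>" and "degree_zero_map eW"
    by (rule degree_zero_map.intro; fact f_linear f_degree target.expectation.f_linear
        target.expectation.f_degree)+
  moreover have "\<alpha> 1 = 1"
    using fun_cong[OF map_unit, of 1] by (simp add: source.unit_one target.unit_one)
  ultimately show ?thesis
    using total_cumulant_natural[of \<alpha> eW] assms(4) by (simp add: map_expectation)
qed

end
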